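(* Let $\boldsymbol p\in\mathbb N_0^2\setminus\{(0,0)\}$. For a symbol correspondence $W:\mathcal B(\mathcal H_{\boldsymbol p})\to C^\infty_{\mathbb C}(\mathcal E)$ with operator kernel $K$ and characteristic matrices $\mathbf C(\boldsymbol a)$, the integral trikernel is of the form $$\mathbb L^W_{\boldsymbol p}(\mathrm z_1,\mathrm z_2,\mathrm z_3)=(\dim\boldsymbol p)^2\operatorname{tr}\big(\widetilde K(\mathrm z_1)\widetilde K(\mathrm z_2)K(\mathrm z_3)\big)$$ $$=(-1)^{|\boldsymbol p|}\sqrt{\dim(\boldsymbol p)}\sum_{\substack{(\boldsymbol a_k;\sigma_k)\\ \boldsymbol\nu_k,J_k}}\begin{bmatrix}(\boldsymbol a_1;\sigma_1)&(\boldsymbol a_2;\sigma_2)&(\boldsymbol a_3;\sigma_3)\\ \boldsymbol\nu_1,J_1&\boldsymbol\nu_2,J_2&\boldsymbol\nu_3,J_3\end{bmatrix}[\boldsymbol p]\;\overline{Z\widetilde{\mathbf C}(\boldsymbol a_1)^{\sigma_1}_{\boldsymbol\nu_1,J_1}}(\mathrm z_1)\;\overline{Z\widetilde{\mathbf C}(\boldsymbol a_2)^{\sigma_2}_{\boldsymbol\nu_2,J_2}}(\mathrm z_2)\;\overline{Z\mathbf C(\check{\boldsymbol a}_3)^{\sigma_3}_{\boldsymbol\nu_3,J_3}}(\mathrm z_3),$$ where the $(\boldsymbol a_k;\sigma_k)$, $k=1,2,3$, run over the Clebsch-Gordan series of $\boldsymbol p\otimes\check{\boldsymbol p}$, $(\boldsymbol\nu_k,J_k)$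 runs over the GT labels of $\boldsymbol a_k$ for $k=1,2$ and of $\check{\boldsymbol a}_3$ for $k=3$, and $\widetilde{\mathbf C}(\boldsymbol a)$ are the characteristic matrices of the operator kernel $\widetilde K$ canonically dual to $K$, so that the associated reproducing kernel is $$\mathcal R^W_{\boldsymbol p}(\mathrm z_1,\mathrm z_2)=\sum_{\substack{(\boldsymbol a;\sigma)\\ \boldsymbol\nu,J}}\overline{Z\widetilde{\mathbf C}(\boldsymbol a)^\sigma_{\boldsymbol\nu,J}}(\mathrm z_1)\;Z\mathbf C(\boldsymbol a)^\sigma_{\boldsymbol\nu,J}(\mathrm z_2).$$
   Context: Representations. In a representation of $SU(3)$ (extended to $\mathfrak{sl}(3,\mathbb C)$) let $T_+,T_-,T_3,U_+,U_-,U_3$ be the images of $E_{12},E_{21},\tfrac12(E_{11}-E_{22}),E_{23},E_{32},\tfrac12(E_{22}-E_{33})$. For $\boldsymbol p=(p,q)\in\mathbb N_0^2$, "the irrep $\boldsymbol p$" is the unitary irrep on $\mathcal H_{\boldsymbol p}$ whose highest weight vector has eigenvalue $p/2$ for $T_3$ and $q/2$ for $U_3$; $\dim(\boldsymbol p)=\frac{(p+1)(q+1)(p+q+2)}2$, $|\boldsymbol p|=p+q$, $\check{\boldsymbol p}=(q,p)$ (the dual irrep). Inner products are linear in the second entry. Gelfand-Tsetlin (GT) basis: an orthonormal basis $\{\boldsymbol e(\boldsymbol p;\boldsymbol\nu,J)\}$ indexed by $\boldsymbol\nu=(\nu_1,\nu_2,\nu_3)$ and $J$ where, for integers $0\le r_-\le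 q\le r_+\le p+q$ and $r_-\le\nu_3\le r_+$: $\nu_1=p+2q-(r_++r_-)$, $\nu_2=r_++r_--\nu_3$, $J=\frac12(r_+-r_-)$. Put $t_{\boldsymbol\nu}=\frac{\nu_1-\nu_2}2$, $u_{\boldsymbol\nu}=\frac{\nu_2-\nu_3}2$ (the eigenvalues of $T_3,U_3$). The basis is determined by a unit highest weight vector $\boldsymbol e(\boldsymbol p;(p+q,q,0),q/2)$ via, with $u=u_{\boldsymbol\nu}$, $U_-\boldsymbol e(\boldsymbol p;\boldsymbol\nu,J)=\sqrt{(J+u)(J-u+1)}\,\boldsymbol e(\boldsymbol p;(\nu_1,\nu_2-1,\nu_3+1),J)$ and $T_-\boldsymbol e(\boldsymbol p;\boldsymbol\nu,J)=\sqrt{\tfrac{(J-u)(p+q+J-u-\nu_3+1)(q+J-u-\nu_3)(u-J+\nu_3+1)}{2J(2J+1)}}\,\boldsymbol e(\boldsymbol p;(\nu_1-1,\nu_2+1,\nu_3),J-\tfrac12)+\sqrt{\tfrac{(J+u+1)(p+q-J-u-\nu_3)(J+u+1+\nu_3-q)(J+u+2+\nu_3)}{2(J+1)(2J+1)}}\,\boldsymbol e(\boldsymbol p;(\nu_1-1,\nu_2+1,\nu_3),J+\tfrac12)$ (terms with zero numerator are $0$). For a GT label $\boldsymbol\nu$ of an irrep $\boldsymbol a$ put $\check{\boldsymbol\nu}=(|\boldsymbol a|,|\boldsymbol a|,|\boldsymbol a|)-\boldsymbol\nu$, a GT label of $\check{\boldsymbol a}$. The induced GT basis of $\mathcal H_{\check{\boldsymbol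 p}}=\mathcal H_{\boldsymbol p}^*$ is $\check{\boldsymbol e}(\check{\boldsymbol p};\check{\boldsymbol\nu},J)=(-1)^{2(t_{\boldsymbol\nu}+u_{\boldsymbol\nu})}\boldsymbol e^*(\boldsymbol p;\boldsymbol\nu,J)$. Wigner functions: $D^{\boldsymbol a}_{\boldsymbol\nu J,\boldsymbol\mu L}(g)=\langle\boldsymbol e(\boldsymbol a;\boldsymbol\nu,J)|\rho(g)\boldsymbol e(\boldsymbol a;\boldsymbol\mu,L)\rangle$. Coupled basis. $\mathcal B(\mathcal H_{\boldsymbol p})\simeq\mathcal H_{\boldsymbol p}\otimes\mathcal H_{\boldsymbol p}^*$ (the representation $\boldsymbol p\otimes\check{\boldsymbol p}$), with action $A^g=\rho(g)A\rho(g)^{-1}$ and inner product $\operatorname{tr}(A^\dagger B)$, is decomposed orthogonally into irreps $(\boldsymbol a;\sigma)$ of class $\boldsymbol a$, $1\le\sigma\le\mathfrak m(\boldsymbol p;\boldsymbol a)$ (the multiplicity); this is the Clebsch-Gordan series. A coupled basis is the union of GT bases $\boldsymbol e((\boldsymbol a;\sigma);\boldsymbol\nu,J)$ of the $(\boldsymbol a;\sigma)$. Clebsch-Gordan coefficients: $C^{\boldsymbol p,\check{\boldsymbol p},(\boldsymbol a;\sigma)}_{\boldsymbol\nu_1J_1,\boldsymbol\nu_2J_2,\boldsymbol\nu J}=\langle\boldsymbol e((\boldsymbol a;\sigma);\boldsymbol\nu,J)|\boldsymbol e(\boldsymbol p;\boldsymbol\nu_1,J_1)\otimes\check{\boldsymbol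 e}(\check{\boldsymbol p};\boldsymbol\nu_2,J_2)\rangle$. Decomposition and phases are chosen so that these are all real, $\boldsymbol e((\boldsymbol a;\sigma);\boldsymbol\nu,J)^\dagger=(-1)^{2(t_{\boldsymbol\nu}+u_{\boldsymbol\nu})}\boldsymbol e((\check{\boldsymbol a};\sigma);\check{\boldsymbol\nu},J)$, and $\boldsymbol e((0,0);(0,0,0),0)=\mathds 1/\sqrt{\dim\boldsymbol p}$ (possible by known results). Wigner product symbol: for $(\boldsymbol a_1;\sigma_1),(\boldsymbol a_2;\sigma_2),(\boldsymbol a;\sigma)$ in the Clebsch-Gordan series of $\boldsymbol p\otimes\check{\boldsymbol p}$, GT labels $(\boldsymbol\nu_i,J_i)$ of $\boldsymbol a_i$ and $(\boldsymbol\nu,J)$ of $\check{\boldsymbol a}$, $$\begin{bmatrix}(\boldsymbol a_1;\sigma_1)&(\boldsymbol a_2;\sigma_2)&(\boldsymbol a;\sigma)\\ \boldsymbol\nu_1,J_1&\boldsymbol\nu_2,J_2&\boldsymbol\nu,J\end{bmatrix}[\boldsymbol p]=\sum_{\substack{\boldsymbol\mu_1,\boldsymbol\mu_2,\boldsymbol\mu_3\\ I_1,I_2,I_3}}(-1)^{|\boldsymbol p|+2(t_{\boldsymbol\nu}+t_{\boldsymbol\mu_2}+u_{\boldsymbol\nu}+u_{\boldsymbol\mu_2})}C^{\boldsymbol p,\check{\boldsymbol p},(\boldsymbol a_1;\sigma_1)}_{\boldsymbol\mu_1I_1,\boldsymbol\mu_2I_2,\boldsymbol\nu_1J_1}C^{\boldsymbol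 p,\check{\boldsymbol p},(\boldsymbol a_2;\sigma_2)}_{\check{\boldsymbol\mu}_2I_2,\boldsymbol\mu_3I_3,\boldsymbol\nu_2J_2}C^{\boldsymbol p,\check{\boldsymbol p},(\boldsymbol a;\sigma)}_{\boldsymbol\mu_1I_1,\boldsymbol\mu_3I_3,\check{\boldsymbol\nu}J},$$ the sum being over GT labels $(\boldsymbol\mu_1,I_1)$ of $\boldsymbol p$ and $(\boldsymbol\mu_2,I_2),(\boldsymbol\mu_3,I_3)$ of $\check{\boldsymbol p}$. Symbol correspondences. $\mathcal E\simeq SU(3)/T$ is the full flag manifold, $T$ the diagonal maximal torus, $\mathrm z_0\in\mathcal E$ a point with isotropy group $T$, with the invariant integral of total mass $1$ and $\langle f_1|f_2\rangle=\int\overline{f_1}f_2\,d\mathrm z$. For $\boldsymbol a=(a,b)$ with $a\equiv b\pmod 3$ (true for all $\boldsymbol a$ in $\boldsymbol p\otimes\check{\boldsymbol p}$): $m(\boldsymbol a)=\min\{a,b\}+1$, $\boldsymbol 0_{\boldsymbol a}=(c,c,c)$ with $c=(a+2b)/3$, $J^\gamma_{\boldsymbol a}=\gamma-1+|a-b|/3$ for $1\le\gamma\le m(\boldsymbol a)$; harmonics $Z^{(\boldsymbol a,\gamma)}_{\boldsymbol\nu,J}(g\mathrm z_0)=\sqrt{\dim\boldsymbol a}\;\overline{D^{\boldsymbol a}_{\boldsymbol\nu J,\boldsymbol 0_{\boldsymbol a}J^\gamma_{\boldsymbol a}}(g)}$. A symbol correspondence $W:\mathcal B(\mathcal H_{\boldsymbol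 p})\to C^\infty_{\mathbb C}(\mathcal E)$ is an injective linear map with: (1) $W_{A^g}=(W_A)^g$, where $f^g(\mathrm z)=f(g^{-1}\mathrm z)$; (2) $W_{A^\dagger}=\overline{W_A}$; (3) $\int W_A\,d\mathrm z=\operatorname{tr}(A)/\dim(\boldsymbol p)$. It has a unique operator kernel $K$, fixed by $T$, with $W_A(\mathrm z)=\operatorname{tr}(AK(\mathrm z))$, $K(g\mathrm z_0)=K^g$. Its characteristic matrices $\mathbf C(\boldsymbol a)=(c^\sigma_\gamma(\boldsymbol a))$, of order $m(\boldsymbol a)\times\mathfrak m(\boldsymbol p;\boldsymbol a)$, are defined by $W:\sqrt{\dim\boldsymbol p}\,\boldsymbol e((\boldsymbol a;\sigma);\boldsymbol\nu,J)\mapsto\sum_{\gamma=1}^{m(\boldsymbol a)}c^\sigma_\gamma(\boldsymbol a)Z^{(\boldsymbol a,\gamma)}_{\boldsymbol\nu,J}=:Z\mathbf C(\boldsymbol a)^\sigma_{\boldsymbol\nu,J}$ (and $Z\widetilde{\mathbf C}$ is defined likewise from $\widetilde{\mathbf C}$). The canonical dual $\widetilde W$ of $W$ is the unique symbol correspondence with the same image as $W$ and $\langle\widetilde W_{A_1}|W_{A_2}\rangle=\frac1{\dim\boldsymbol p}\operatorname{tr}(A_1^\dagger A_2)$ for all $A_1,A_2$; $\widetilde K$ is its operator kernel. The twisted product induced by $W$ on its image $\mathcal S$ is $W_{A_1}\star W_{A_2}=W_{A_1A_2}$. The integral trikernel is $\mathbb L^W_{\boldsymbol p}(\mathrm z_1,\mathrm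 z_2,\mathrm z)=(\dim\boldsymbol p)^2\operatorname{tr}(\widetilde K(\mathrm z_1)\widetilde K(\mathrm z_2)K(\mathrm z))$, for which $(f_1\star f_2)(\mathrm z)=\int f_1(\mathrm z_1)f_2(\mathrm z_2)\mathbb L^W_{\boldsymbol p}(\mathrm z_1,\mathrm z_2,\mathrm z)\,d\mathrm z_1d\mathrm z_2$ for $f_1,f_2\in\mathcal S$. The associated reproducing kernel for $\mathcal S$ is $\mathcal R^W_{\boldsymbol p}(\mathrm z_1,\mathrm z_2)=\int\mathbb L^W_{\boldsymbol p}(\mathrm z,\mathrm z_1,\mathrm z_2)\,d\mathrm z=\int\mathbb L^W_{\boldsymbol p}(\mathrm z_1,\mathrm z,\mathrm z_2)\,d\mathrm z$. *)

theory Defs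
  imports "HOL-Analysis.Analysis" "HOL-Analysis.Finite_Function_Topology"
    "HOL-Probability.Probability_Measure"
begin

section \<open>Complex vector spaces with a Hermitian inner product\<close>

text \<open>
  The inner product is linear in the second argument.  The norm inherited from
  \<^class>\<open>real_normed_vector\<close> is not required to be the one induced by the inner product;
  it only supplies the topology, which on finite-dimensional subspaces is canonical.
\<close>

class cinner_space = real_normed_vector +
  fixes cscale :: "complex \<Rightarrow> 'a \<Rightarrow> 'a" (infixr "*\<^sub>C" 75)
    and cinner :: "'a \<Rightarrow> 'a \<Rightarrow> complex"
  assumes cscale_of_real: "complex_of_real r *\<^sub>C x = r *\<^sub>R x"
    and cscale_add_right: "a *\<^sub>C (x + y) = a *\<^sub>C x + a *\<^sub>C y"
    and cscale_add_left: "(a + b) *\<^sub>C x = a *\<^sub>C x + b *\<^sub>C x"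
    and cscale_cscale: "a *\<^sub>C (b *\<^sub>C x) = (a * b) *\<^sub>C x"
    and cinner_cnj: "cinner x y = cnj (cinner y x)"
    and cinner_add_right: "cinner x (y + z) = cinner x y + cinner x z"
    and cinner_scale_right: "cinner x (a *\<^sub>C y) = a * cinner x y"
    and cinner_self_nonneg: "Im (cinner x x) = 0 \<and> Re (cinner x x) \<ge> 0"
    and cinner_self_eq_0: "cinner x x = 0 \<longleftrightarrow> x = 0"

global_interpretation cvs: vector_space "cscale :: complex \<Rightarrow> 'a::cinner_space \<Rightarrow> 'a"
proof
  fix x :: 'a
  show "1 *\<^sub>C x = x" using cscale_of_real[of 1 x] by simp
qed (rule cscale_add_right cscale_add_left cscale_cscale)+

instantiation complex :: cinner_space
begin
definition "cscale_complex (a::complex) x = a * x"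
definition "cinner_complex (x::complex) y = cnj x * y"
instance
proof
  fix x :: complex
  show "Im (cinner x x) = 0 \<and> Re (cinner x x) \<ge> 0"
    by (simp add: cinner_complex_def)
qed (auto simp: cscale_complex_def cinner_complex_def scaleR_conv_of_real algebra_simps)
end

instantiation vec :: (cinner_space, finite) cinner_space
begin
definition "cscale_vec a (x::'a^'b) = (\<chi> i. a *\<^sub>C (x $ i))"
definition "cinner_vec (x::'a^'b) y = (\<Sum>i\<in>UNIV. cinner (x $ i) (y $ i))"
instance
proof
  fix x y :: "'a^'b"
  show "cinner x y = cnj (cinner y x)"
    unfolding cinner_vec_def cnj_sum by (intro sum.cong refl cinner_cnj)
  show "Im (cinner x x) = 0 \<and> Re (cinner x x) \<ge> 0"
    by (auto simp: cinner_vec_def cinner_self_nonneg intro!: sum_nonneg)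
  show "cinner x x = 0 \<longleftrightarrow> x = 0"
  proof
    assume "cinner x x = 0"
    then have "(\<Sum>i\<in>UNIV. Re (cinner (x $ i) (x $ i))) = 0"
      by (simp add: cinner_vec_def flip: Re_sum)
    then have "\<forall>i\<in>UNIV. Re (cinner (x $ i) (x $ i)) = 0"
      by (subst (asm) sum_nonneg_eq_0_iff) (auto simp: cinner_self_nonneg)
    then have "\<And>i. cinner (x $ i) (x $ i) = 0"
      by (simp add: complex_eq_iff cinner_self_nonneg)
    then show "x = 0" by (simp add: vec_eq_iff cinner_self_eq_0)
  next
    show "x = 0 \<Longrightarrow> cinner x x = 0"
      by (simp add: cinner_vec_def cinner_self_eq_0)
  qed
qed (auto simp: cscale_vec_def cinner_vec_def vec_eq_iff cscale_of_real cscale_add_right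
      cscale_add_left cscale_cscale cinner_add_right cinner_scale_right sum.distrib sum_distrib_left)
end

instantiation poly_mapping :: (type, cinner_space) cinner_space
begin
definition "cscale_poly_mapping a (x::'a \<Rightarrow>\<^sub>0 'b) = Poly_Mapping.map (cscale a) x"
definition "cinner_poly_mapping (x::'a \<Rightarrow>\<^sub>0 'b) y =
  (\<Sum>k\<in>Poly_Mapping.keys x. cinner (Poly_Mapping.lookup x k) (Poly_Mapping.lookup y k))"
instance
proof
  have lc: "Poly_Mapping.lookup (a *\<^sub>C x) k = a *\<^sub>C Poly_Mapping.lookup x k"
    for a and x :: "'a \<Rightarrow>\<^sub>0 'b" and k
    by (simp add: cscale_poly_mapping_def Poly_Mapping.map.rep_eq when_def)
  have lr: "Poly_Mapping.lookup (r *\<^sub>R x) k = r *\<^sub>R Poly_Mapping.lookup x k"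
    for r and x :: "'a \<Rightarrow>\<^sub>0 'b" and k
  proof -
    have "{i. r *\<^sub>R Poly_Mapping.lookup x i \<noteq> 0} \<subseteq> Poly_Mapping.keys x"
      by (auto simp: in_keys_iff)
    then have "finite {i. r *\<^sub>R Poly_Mapping.lookup x i \<noteq> 0}"
      by (rule finite_subset) simp
    then show ?thesis
      by (simp add: scaleR_poly_mapping_def Abs_poly_mapping_inverse)
  qed
  have z1: "cinner 0 v = 0" for v :: 'b
    by (metis cinner_cnj cinner_scale_right complex_cnj_zero cvs.scale_zero_left mult_zero_left)
  have ext: "cinner x y = (\<Sum>k\<in>F. cinner (Poly_Mapping.lookup x k) (Poly_Mapping.lookup y k))"
    if "finite F" "Poly_Mapping.keys x \<subseteq> F" for F and x y :: "'a \<Rightarrow>\<^sub>0 'b"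
    unfolding cinner_poly_mapping_def
    using that by (intro sum.mono_neutral_left) (auto simp: in_keys_iff z1)
  fix r :: real and a b :: complex and x y z :: "'a \<Rightarrow>\<^sub>0 'b"
  show "complex_of_real r *\<^sub>C x = r *\<^sub>R x"
    by (rule poly_mapping_eqI) (simp add: lc lr cscale_of_real)
  show "a *\<^sub>C (x + y) = a *\<^sub>C x + a *\<^sub>C y"
    by (rule poly_mapping_eqI) (simp add: lc lookup_add cscale_add_right)
  show "(a + b) *\<^sub>C x = a *\<^sub>C x + b *\<^sub>C x"
    by (rule poly_mapping_eqI) (simp add: lc lookup_add cscale_add_left)
  show "a *\<^sub>C (b *\<^sub>C x) = (a * b) *\<^sub>C x"
    by (rule poly_mapping_eqI) (simp add: lc cscale_cscale)
  show "cinner x (y + z) = cinner x y + cinner x z"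
    by (simp add: cinner_poly_mapping_def lookup_add cinner_add_right sum.distrib)
  show "cinner x (a *\<^sub>C y) = a * cinner x y"
    by (simp add: cinner_poly_mapping_def lc cinner_scale_right sum_distrib_left)
  show "cinner x y = cnj (cinner y x)"
  proof -
    let ?F = "Poly_Mapping.keys x \<union> Poly_Mapping.keys y"
    have "cinner x y = (\<Sum>k\<in>?F. cinner (Poly_Mapping.lookup x k) (Poly_Mapping.lookup y k))"
      by (rule ext) auto
    also have "\<dots> = cnj (\<Sum>k\<in>?F. cinner (Poly_Mapping.lookup y k) (Poly_Mapping.lookup x k))"
      unfolding cnj_sum by (intro sum.cong refl cinner_cnj)
    also have "(\<Sum>k\<in>?F. cinner (Poly_Mapping.lookup y k) (Poly_Mapping.lookup x k)) = cinner y x"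
      by (rule ext[symmetric]) auto
    finally show ?thesis .
  qed
  show "Im (cinner x x) = 0 \<and> Re (cinner x x) \<ge> 0"
    by (auto simp: cinner_poly_mapping_def cinner_self_nonneg intro!: sum_nonneg)
  show "cinner x x = 0 \<longleftrightarrow> x = 0"
  proof
    assume "cinner x x = 0"
    then have "(\<Sum>k\<in>Poly_Mapping.keys x.
        Re (cinner (Poly_Mapping.lookup x k) (Poly_Mapping.lookup x k))) = 0"
      by (simp add: cinner_poly_mapping_def flip: Re_sum)
    then have "\<forall>k\<in>Poly_Mapping.keys x.
        Re (cinner (Poly_Mapping.lookup x k) (Poly_Mapping.lookup x k)) = 0"
      by (subst (asm) sum_nonneg_eq_0_iff) (auto simp: cinner_self_nonneg)
    then have "Poly_Mapping.lookup x k = 0" if "k \<in> Poly_Mapping.keys x" for k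
      using that cinner_self_nonneg cinner_self_eq_0 by (metis complex_eq_iff zero_complex.sel)
    then show "x = 0" by (intro poly_mapping_eqI) (metis in_keys_iff lookup_zero)
  next
    show "x = 0 \<Longrightarrow> cinner x x = 0" by (simp add: cinner_poly_mapping_def)
  qed
qed
end

definition mat_adj :: "complex^'n^'m \<Rightarrow> complex^'m^'n" where
  "mat_adj A = (\<chi> i j. cnj (A $ j $ i))"

lemma cinner_matrix_eq_trace: "cinner A B = trace (mat_adj A ** B)"
  for A B :: "complex^'n^'n"
proof -
  have "cinner A B = (\<Sum>i\<in>UNIV. \<Sum>j\<in>UNIV. cnj (A $ i $ j) * B $ i $ j)"
    by (simp add: cinner_vec_def cinner_complex_def)
  also have "\<dots> = (\<Sum>j\<in>UNIV. \<Sum>i\<in>UNIV. cnj (A $ i $ j) * B $ i $ j)"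
    by (rule sum.swap)
  also have "\<dots> = trace (mat_adj A ** B)"
    by (simp add: trace_def matrix_matrix_mult_def mat_adj_def)
  finally show ?thesis .
qed


section \<open>SU(3), its representations and the operators of sl(3,C)\<close>

definition SU3 :: "(complex^3^3) set" where
  "SU3 = {A. mat_adj A ** A = mat 1 \<and> det A = 1}"

definition mexp :: "complex^3^3 \<Rightarrow> complex^3^3" where
  "mexp A = suminf (\<lambda>n. (1 / fact n) *\<^sub>R (((**) A ^^ n) (mat 1)))"

definition unitary_rep :: "'v::cinner_space set \<Rightarrow> (complex^3^3 \<Rightarrow> 'v \<Rightarrow> 'v) \<Rightarrow> bool" where
  "unitary_rep V R \<longleftrightarrow>
     cvs.subspace V \<and> (\<exists>B. finite B \<and> V = cvs.span B) \<and>
     (\<forall>g\<in>SU3. \<forall>v\<in>V. R g v \<in> V) \<and>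
     (\<forall>g\<in>SU3. \<forall>v\<in>V. \<forall>w\<in>V. R g (v + w) = R g v + R g w) \<and>
     (\<forall>g\<in>SU3. \<forall>c. \<forall>v\<in>V. R g (c *\<^sub>C v) = c *\<^sub>C R g v) \<and>
     (\<forall>v\<in>V. R (mat 1) v = v) \<and>
     (\<forall>g\<in>SU3. \<forall>h\<in>SU3. \<forall>v\<in>V. R (g ** h) v = R g (R h v)) \<and>
     (\<forall>g\<in>SU3. \<forall>v\<in>V. \<forall>w\<in>V. cinner (R g v) (R g w) = cinner v w) \<and>
     (\<forall>v\<in>V. continuous_on SU3 (\<lambda>g. R g v))"

definition irreducible_rep :: "'v::cinner_space set \<Rightarrow> (complex^3^3 \<Rightarrow> 'v \<Rightarrow> 'v) \<Rightarrow> bool" where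
  "irreducible_rep V R \<longleftrightarrow> V \<noteq> {0} \<and>
     (\<forall>U. cvs.subspace U \<and> U \<subseteq> V \<and> (\<forall>g\<in>SU3. \<forall>u\<in>U. R g u \<in> U) \<longrightarrow> U = {0} \<or> U = V)"

definition lie_rep :: "(complex^3^3 \<Rightarrow> 'v \<Rightarrow> 'v::cinner_space) \<Rightarrow> complex^3^3 \<Rightarrow> 'v \<Rightarrow> 'v" where
  "lie_rep R X v = vector_derivative (\<lambda>t. R (mexp (t *\<^sub>R X)) v) (at 0)"

text \<open>
  The complex-linear extension to sl(3,C): a traceless \<open>Z\<close> is \<open>X + \<i> Y\<close> with
  \<open>X = (Z - Z\<^sup>\<dagger>) / 2\<close> and \<open>Y = -\<i> (Z + Z\<^sup>\<dagger>) / 2\<close> both in su(3).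
\<close>

definition lie_rep_C :: "(complex^3^3 \<Rightarrow> 'v \<Rightarrow> 'v::cinner_space) \<Rightarrow> complex^3^3 \<Rightarrow> 'v \<Rightarrow> 'v" where
  "lie_rep_C R Z v =
     lie_rep R ((1/2) *\<^sub>C (Z - mat_adj Z)) v + \<i> *\<^sub>C lie_rep R ((- \<i>/2) *\<^sub>C (Z + mat_adj Z)) v"

definition mat_unit :: "3 \<Rightarrow> 3 \<Rightarrow> complex^3^3" where
  "mat_unit i j = (\<chi> k l. if k = i \<and> l = j then 1 else 0)"

definition "T_plus R = lie_rep_C R (mat_unit 1 2)"
definition "T_minus R = lie_rep_C R (mat_unit 2 1)"
definition "T_three R = lie_rep_C R ((1/2) *\<^sub>C (mat_unit 1 1 - mat_unit 2 2))"
definition "U_plus R = lie_rep_C R (mat_unit 2 3)"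
definition "U_minus R = lie_rep_C R (mat_unit 3 2)"
definition "U_three R = lie_rep_C R ((1/2) *\<^sub>C (mat_unit 2 2 - mat_unit 3 3))"

type_synonym irr = "nat \<times> nat"

definition dual_irr :: "irr \<Rightarrow> irr" where
  "dual_irr a = (snd a, fst a)"

definition size_irr :: "irr \<Rightarrow> int" where
  "size_irr a = int (fst a + snd a)"

definition dim_irr :: "irr \<Rightarrow> real" where
  "dim_irr a = (real (fst a) + 1) * (real (snd a) + 1) * (real (fst a) + real (snd a) + 2) / 2"

definition highest_weight_vector ::
  "(complex^3^3 \<Rightarrow> 'v \<Rightarrow> 'v::cinner_space) \<Rightarrow> irr \<Rightarrow> 'v \<Rightarrow> bool" where
  "highest_weight_vector R a v \<longleftrightarrow> v \<noteq> 0 \<and> T_plus R v = 0 \<and> U_plus R v = 0 \<and>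
     T_three R v = complex_of_real (real (fst a) / 2) *\<^sub>C v \<and>
     U_three R v = complex_of_real (real (snd a) / 2) *\<^sub>C v"

definition unitary_irrep ::
  "'v::cinner_space set \<Rightarrow> (complex^3^3 \<Rightarrow> 'v \<Rightarrow> 'v) \<Rightarrow> irr \<Rightarrow> bool" where
  "unitary_irrep V R a \<longleftrightarrow> unitary_rep V R \<and> irreducible_rep V R \<and>
     (\<exists>v\<in>V. highest_weight_vector R a v)"


section \<open>Gelfand-Tsetlin bases and Wigner functions\<close>

type_synonym gt_label = "(int \<times> int \<times> int) \<times> real"

definition gt_labels :: "irr \<Rightarrow> gt_label set" where
  "gt_labels a = (case a of (p, q) \<Rightarrow>
     {((int p + 2 * int q - (rp + rm), rp + rm - n3, n3), real_of_int (rp - rm) / 2) | rp rm n3.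
        0 \<le> rm \<and> rm \<le> int q \<and> int q \<le> rp \<and> rp \<le> int p + int q \<and> rm \<le> n3 \<and> n3 \<le> rp})"

fun t_val :: "gt_label \<Rightarrow> real" where
  "t_val ((n1, n2, n3), J) = real_of_int (n1 - n2) / 2"

fun u_val :: "gt_label \<Rightarrow> real" where
  "u_val ((n1, n2, n3), J) = real_of_int (n2 - n3) / 2"

text \<open>The integer \<open>2 (t + u)\<close>, used in the phases.\<close>

fun phase_exp :: "gt_label \<Rightarrow> int" where
  "phase_exp ((n1, n2, n3), J) = n1 - n3"

lemma phase_exp_eq: "real_of_int (phase_exp l) = 2 * (t_val l + u_val l)"
  by (cases l rule: phase_exp.cases) (simp add: field_simps)

fun dual_label :: "irr \<Rightarrow> gt_label \<Rightarrow> gt_label" where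
  "dual_label a ((n1, n2, n3), J) = ((size_irr a - n1, size_irr a - n2, size_irr a - n3), J)"

text \<open>
  In the action of \<open>T\<^sub>-\<close> and \<open>U\<^sub>-\<close> on basis vectors, the coefficient in front of
  an \<open>e\<close> whose argument is not a label of the irrep vanishes; for \<open>J = 0\<close> the first
  coefficient of \<open>T\<^sub>-\<close> is \<open>sqrt (0 / 0) = 0\<close>.
\<close>

definition gt_basis ::
  "'v::cinner_space set \<Rightarrow> (complex^3^3 \<Rightarrow> 'v \<Rightarrow> 'v) \<Rightarrow> irr \<Rightarrow> (gt_label \<Rightarrow> 'v) \<Rightarrow> bool" where
  "gt_basis V R a e \<longleftrightarrow> (case a of (p, q) \<Rightarrow>
     cvs.span (e ` gt_labels a) = V \<and>
     (\<forall>l\<in>gt_labels a. \<forall>l'\<in>gt_labels a. cinner (e l) (e l') = (if l = l' then 1 else 0)) \<and>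
     highest_weight_vector R a (e ((int p + int q, int q, 0), real q / 2)) \<and>
     (\<forall>n1 n2 n3 J. ((n1, n2, n3), J) \<in> gt_labels a \<longrightarrow>
        (let u = u_val ((n1, n2, n3), J); n = real_of_int n3; P = real p; Q = real q in
           U_minus R (e ((n1, n2, n3), J)) =
             complex_of_real (sqrt ((J + u) * (J - u + 1))) *\<^sub>C e ((n1, n2 - 1, n3 + 1), J) \<and>
           T_minus R (e ((n1, n2, n3), J)) =
             complex_of_real (sqrt (((J - u) * (P + Q + J - u - n + 1) * (Q + J - u - n)
                 * (u - J + n + 1)) / (2 * J * (2 * J + 1))))
               *\<^sub>C e ((n1 - 1, n2 + 1, n3), J - 1/2)
             + complex_of_real (sqrt (((J + u + 1) * (P + Q - J - u - n) * (J + u + 1 + n - Q)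
                 * (J + u + 2 + n)) / (2 * (J + 1) * (2 * J + 1))))
               *\<^sub>C e ((n1 - 1, n2 + 1, n3), J + 1/2))))"

text \<open>
  The matrix coefficients of the irrep of class \<open>a\<close> in a GT basis.  They do not depend on
  the choice of the irrep within its class nor on the phase of the highest weight vector; the space
  of finitely supported functions of labels has room for an irrep of every class.
\<close>

definition wigner_D :: "irr \<Rightarrow> complex^3^3 \<Rightarrow> gt_label \<Rightarrow> gt_label \<Rightarrow> complex" where
  "wigner_D a = (SOME D. \<exists>V R (e :: gt_label \<Rightarrow> (gt_label \<Rightarrow>\<^sub>0 complex)).
     unitary_irrep V R a \<and> gt_basis V R a e \<and> D = (\<lambda>g l l'. cinner (e l) (R g (e l'))))"


section \<open>Coupled bases, Clebsch-Gordan coefficients and Wigner product symbols\<close>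

definition vec_action :: "(complex^3^3 \<Rightarrow> complex^'n^'n) \<Rightarrow> complex^3^3 \<Rightarrow> complex^'n \<Rightarrow> complex^'n" where
  "vec_action \<rho> g v = \<rho> g *v v"

definition op_action ::
  "(complex^3^3 \<Rightarrow> complex^'n^'n) \<Rightarrow> complex^3^3 \<Rightarrow> complex^'n^'n \<Rightarrow> complex^'n^'n" where
  "op_action \<rho> g A = \<rho> g ** A ** matrix_inv (\<rho> g)"

text \<open>The induced GT basis of the dual space, consisting of linear functionals.\<close>

definition dual_gt :: "irr \<Rightarrow> (gt_label \<Rightarrow> complex^'n) \<Rightarrow> gt_label \<Rightarrow> complex^'n \<Rightarrow> complex" where
  "dual_gt p e l = (let l' = dual_label (dual_irr p) l in
     (\<lambda>w. (- 1) powi phase_exp l' * cinner (e l') w))"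

text \<open>The operator corresponding to \<open>v \<otimes> f\<close>, for \<open>f\<close> a linear functional.\<close>

definition tensor_op :: "complex^'n \<Rightarrow> (complex^'n \<Rightarrow> complex) \<Rightarrow> complex^'n^'n" where
  "tensor_op v f = matrix (\<lambda>w. f w *\<^sub>C v)"

text \<open>
  The function \<open>m\<close> gives the multiplicities and \<open>ec a \<sigma>\<close> the GT basis of the
  irrep \<open>(a; \<sigma>)\<close>, a subspace of the space of operators.
\<close>

definition cg_series :: "(irr \<Rightarrow> nat) \<Rightarrow> (irr \<times> nat) set" where
  "cg_series m = {(a, \<sigma>). 1 \<le> \<sigma> \<and> \<sigma> \<le> m a}"

definition coupled_basis ::
  "(complex^3^3 \<Rightarrow> complex^'n^'n) \<Rightarrow> (irr \<Rightarrow> nat) \<Rightarrow> (irr \<Rightarrow> nat \<Rightarrow> gt_label \<Rightarrow> complex^'n^'n) \<Rightarrow> bool" where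
  "coupled_basis \<rho> m ec \<longleftrightarrow>
     (\<forall>(a, \<sigma>)\<in>cg_series m. \<exists>V. unitary_irrep V (op_action \<rho>) a \<and> gt_basis V (op_action \<rho>) a (ec a \<sigma>)) \<and>
     (\<forall>(a, \<sigma>)\<in>cg_series m. \<forall>(a', \<sigma>')\<in>cg_series m. (a, \<sigma>) \<noteq> (a', \<sigma>') \<longrightarrow>
        (\<forall>l\<in>gt_labels a. \<forall>l'\<in>gt_labels a'. cinner (ec a \<sigma> l) (ec a' \<sigma>' l') = 0)) \<and>
     cvs.span (\<Union>(a, \<sigma>)\<in>cg_series m. ec a \<sigma> ` gt_labels a) = UNIV"

definition CG_coeff ::
  "irr \<Rightarrow> (gt_label \<Rightarrow> complex^'n) \<Rightarrow> (irr \<Rightarrow> nat \<Rightarrow> gt_label \<Rightarrow> complex^'n^'n) \<Rightarrow>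
     gt_label \<Rightarrow> gt_label \<Rightarrow> irr \<times> nat \<Rightarrow> gt_label \<Rightarrow> complex" where
  "CG_coeff p e ec l1 l2 s l = cinner (ec (fst s) (snd s) l) (tensor_op (e l1) (dual_gt p e l2))"

definition coupled_phase_conventions ::
  "irr \<Rightarrow> (gt_label \<Rightarrow> complex^'n) \<Rightarrow> (irr \<Rightarrow> nat) \<Rightarrow> (irr \<Rightarrow> nat \<Rightarrow> gt_label \<Rightarrow> complex^'n^'n) \<Rightarrow> bool" where
  "coupled_phase_conventions p e m ec \<longleftrightarrow>
     (\<forall>s\<in>cg_series m. \<forall>l1\<in>gt_labels p. \<forall>l2\<in>gt_labels (dual_irr p). \<forall>l\<in>gt_labels (fst s).
        CG_coeff p e ec l1 l2 s l \<in> \<real>) \<and>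
     (\<forall>(a, \<sigma>)\<in>cg_series m. (dual_irr a, \<sigma>) \<in> cg_series m \<and> (\<forall>l\<in>gt_labels a.
        mat_adj (ec a \<sigma> l) = (- 1) powi phase_exp l *\<^sub>C ec (dual_irr a) \<sigma> (dual_label a l))) \<and>
     ec (0, 0) 1 ((0, 0, 0), 0) = complex_of_real (1 / sqrt (dim_irr p)) *\<^sub>C mat 1"

text \<open>The label \<open>l\<close> of the third column is a label of the dual of its irrep.\<close>

definition wigner_product_symbol ::
  "irr \<Rightarrow> (gt_label \<Rightarrow> complex^'n) \<Rightarrow> (irr \<Rightarrow> nat \<Rightarrow> gt_label \<Rightarrow> complex^'n^'n) \<Rightarrow>
     irr \<times> nat \<Rightarrow> irr \<times> nat \<Rightarrow> irr \<times> nat \<Rightarrow> gt_label \<Rightarrow> gt_label \<Rightarrow> gt_label \<Rightarrow> complex" where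
  "wigner_product_symbol p e ec s1 s2 s l1 l2 l =
     (\<Sum>\<mu>1\<in>gt_labels p. \<Sum>\<mu>2\<in>gt_labels (dual_irr p). \<Sum>\<mu>3\<in>gt_labels (dual_irr p).
        (- 1) powi (size_irr p + phase_exp l + phase_exp \<mu>2)
        * CG_coeff p e ec \<mu>1 \<mu>2 s1 l1
        * CG_coeff p e ec (dual_label (dual_irr p) \<mu>2) \<mu>3 s2 l2
        * CG_coeff p e ec \<mu>1 \<mu>3 s (dual_label (dual_irr (fst s)) l))"


section \<open>The flag manifold\<close>

text \<open>Points of the flag manifold SU(3)/T are left cosets of the diagonal maximal torus \<open>T\<close>.\<close>

definition torus :: "(complex^3^3) set" where
  "torus = {A \<in> SU3. \<forall>i j. i \<noteq> j \<longrightarrow> A $ i $ j = 0}"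

type_synonym flag_pt = "(complex^3^3) set"

definition coset :: "complex^3^3 \<Rightarrow> flag_pt" where
  "coset g = (\<lambda>t. g ** t) ` torus"

definition flags :: "flag_pt set" where
  "flags = coset ` SU3"

definition base_pt :: flag_pt where
  "base_pt = coset (mat 1)"

definition flag_act :: "complex^3^3 \<Rightarrow> flag_pt \<Rightarrow> flag_pt" where
  "flag_act g z = (\<lambda>h. g ** h) ` z"

primrec Ck_on :: "nat \<Rightarrow> ('a::real_normed_vector \<Rightarrow> 'b::real_normed_vector) \<Rightarrow> 'a set \<Rightarrow> bool" where
  "Ck_on 0 f S \<longleftrightarrow> continuous_on S f"
| "Ck_on (Suc k) f S \<longleftrightarrow> (\<forall>x\<in>S. f differentiable (at x)) \<and>
     (\<forall>v. Ck_on k (\<lambda>x. frechet_derivative f (at x) v) S)"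

text \<open>
  A function on SU(3)/T is smooth iff its pullback to SU(3) is, i.e. iff the pullback extends
  locally to a smooth function on an open subset of the ambient matrix space.
\<close>

definition smooth_on_flags :: "(flag_pt \<Rightarrow> complex) \<Rightarrow> bool" where
  "smooth_on_flags f \<longleftrightarrow> (\<forall>g\<in>SU3. \<exists>U F. open U \<and> g \<in> U \<and> (\<forall>k. Ck_on k F U) \<and>
     (\<forall>h\<in>U \<inter> SU3. F h = f (coset h)))"

text \<open>The invariant probability measure on the Borel sets of the quotient topology.\<close>

definition invariant_flag_measure :: "flag_pt measure \<Rightarrow> bool" where
  "invariant_flag_measure M \<longleftrightarrow> prob_space M \<and> space M = flags \<and>
     sets M = sigma_sets flags
       {U. U \<subseteq> flags \<and> openin (top_of_set SU3) {g \<in> SU3. coset g \<in> U}} \<and>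
     (\<forall>g\<in>SU3. distr M M (flag_act g) = M)"


section \<open>Harmonics and symbol correspondences\<close>

definition mult_zero_weight :: "irr \<Rightarrow> nat" where
  "mult_zero_weight a = min (fst a) (snd a) + 1"

text \<open>The label \<open>(0\<^sub>a, J\<^sub>a\<^sup>\<gamma>)\<close>; the division is exact for \<open>a \<equiv> b (mod 3)\<close>.\<close>

definition zero_label :: "irr \<Rightarrow> nat \<Rightarrow> gt_label" where
  "zero_label a \<gamma> = (let c = int (fst a + 2 * snd a) div 3 in
     ((c, c, c), real \<gamma> - 1 + \<bar>real (fst a) - real (snd a)\<bar> / 3))"

text \<open>
  Any \<open>g\<close> with \<open>z = g z\<^sub>0\<close>, i.e. any element of the coset \<open>z\<close>, gives the same value,
  since \<open>T\<close> fixes the vectors of weight zero.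
\<close>

definition harmonic :: "irr \<Rightarrow> nat \<Rightarrow> gt_label \<Rightarrow> flag_pt \<Rightarrow> complex" where
  "harmonic a \<gamma> l z =
     complex_of_real (sqrt (dim_irr a)) * cnj (wigner_D a (SOME g. g \<in> z) l (zero_label a \<gamma>))"

text \<open>The entry \<open>c\<^sup>\<sigma>\<^sub>\<gamma>(a)\<close> of the characteristic matrix is \<open>C a \<gamma> \<sigma>\<close>.\<close>

definition harmonic_comb ::
  "(irr \<Rightarrow> nat \<Rightarrow> nat \<Rightarrow> complex) \<Rightarrow> irr \<Rightarrow> nat \<Rightarrow> gt_label \<Rightarrow> flag_pt \<Rightarrow> complex" where
  "harmonic_comb C a \<sigma> l z = (\<Sum>\<gamma>=1..mult_zero_weight a. C a \<gamma> \<sigma> * harmonic a \<gamma> l z)"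

definition symbol_correspondence ::
  "irr \<Rightarrow> (complex^3^3 \<Rightarrow> complex^'n^'n) \<Rightarrow> flag_pt measure \<Rightarrow>
     (complex^'n^'n \<Rightarrow> flag_pt \<Rightarrow> complex) \<Rightarrow> bool" where
  "symbol_correspondence p \<rho> M W \<longleftrightarrow>
     (\<forall>A. smooth_on_flags (W A)) \<and>
     (\<forall>A B. \<forall>z\<in>flags. W (A + B) z = W A z + W B z) \<and>
     (\<forall>c A. \<forall>z\<in>flags. W (c *\<^sub>C A) z = c * W A z) \<and>
     (\<forall>A B. (\<forall>z\<in>flags. W A z = W B z) \<longrightarrow> A = B) \<and>
     (\<forall>g\<in>SU3. \<forall>A. \<forall>z\<in>flags. W (op_action \<rho> g A) z = W A (flag_act (matrix_inv g) z)) \<and>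
     (\<forall>A. \<forall>z\<in>flags. W (mat_adj A) z = cnj (W A z)) \<and>
     (\<forall>A. (LINT z|M. W A z) = trace A / complex_of_real (dim_irr p))"

definition operator_kernel ::
  "(complex^3^3 \<Rightarrow> complex^'n^'n) \<Rightarrow> (complex^'n^'n \<Rightarrow> flag_pt \<Rightarrow> complex) \<Rightarrow>
     (flag_pt \<Rightarrow> complex^'n^'n) \<Rightarrow> bool" where
  "operator_kernel \<rho> W K \<longleftrightarrow>
     (\<forall>A. \<forall>z\<in>flags. W A z = trace (A ** K z)) \<and>
     (\<forall>t\<in>torus. op_action \<rho> t (K base_pt) = K base_pt) \<and>
     (\<forall>g\<in>SU3. K (flag_act g base_pt) = op_action \<rho> g (K base_pt))"

definition characteristic_matrices ::
  "irr \<Rightarrow> (irr \<Rightarrow> nat) \<Rightarrow> (irr \<Rightarrow> nat \<Rightarrow> gt_label \<Rightarrow> complex^'n^'n) \<Rightarrow>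
     (complex^'n^'n \<Rightarrow> flag_pt \<Rightarrow> complex) \<Rightarrow> (irr \<Rightarrow> nat \<Rightarrow> nat \<Rightarrow> complex) \<Rightarrow> bool" where
  "characteristic_matrices p m ec W C \<longleftrightarrow>
     (\<forall>(a, \<sigma>)\<in>cg_series m. \<forall>l\<in>gt_labels a. \<forall>z\<in>flags.
        W (complex_of_real (sqrt (dim_irr p)) *\<^sub>C ec a \<sigma> l) z = harmonic_comb C a \<sigma> l z)"

definition canonical_dual ::
  "irr \<Rightarrow> (complex^3^3 \<Rightarrow> complex^'n^'n) \<Rightarrow> flag_pt measure \<Rightarrow>
     (complex^'n^'n \<Rightarrow> flag_pt \<Rightarrow> complex) \<Rightarrow> (complex^'n^'n \<Rightarrow> flag_pt \<Rightarrow> complex) \<Rightarrow> bool" where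
  "canonical_dual p \<rho> M W W' \<longleftrightarrow> symbol_correspondence p \<rho> M W' \<and>
     range (\<lambda>A. restrict (W' A) flags) = range (\<lambda>A. restrict (W A) flags) \<and>
     (\<forall>A1 A2. (LINT z|M. cnj (W' A1 z) * W A2 z) =
        trace (mat_adj A1 ** A2) / complex_of_real (dim_irr p))"

text \<open>Here \<open>K'\<close> is the operator kernel of the canonical dual.\<close>

definition trikernel ::
  "irr \<Rightarrow> (flag_pt \<Rightarrow> complex^'n^'n) \<Rightarrow> (flag_pt \<Rightarrow> complex^'n^'n) \<Rightarrow>
     flag_pt \<Rightarrow> flag_pt \<Rightarrow> flag_pt \<Rightarrow> complex" where
  "trikernel p K' K z1 z2 z = (complex_of_real (dim_irr p))\<^sup>2 * trace (K' z1 ** K' z2 ** K z)"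

definition reproducing_kernel ::
  "flag_pt measure \<Rightarrow> (flag_pt \<Rightarrow> flag_pt \<Rightarrow> flag_pt \<Rightarrow> complex) \<Rightarrow> flag_pt \<Rightarrow> flag_pt \<Rightarrow> complex" where
  "reproducing_kernel M L z1 z2 = (LINT z|M. L z z1 z2)"

end

theory Submission
  imports Defs
begin

text \<open>
  Hermiticity of the correspondence, \<open>W\<^bsub>A\<^sup>\<dagger>\<^esub> = cnj W\<^bsub>A\<^esub>\<close>, says that the coefficient of
  \<open>K(z)\<close> along a coupled basis vector \<open>\<epsilon>\<close> is \<open>cnj (W\<^bsub>\<epsilon>\<^esub>(z))\<close>, a multiple of \<open>cnj (Z C)\<close>.  Parseval's
  identity in the coupled basis therefore reduces the trikernel to the traces of triple products
  of coupled basis vectors, and Parseval's identity in the GT basis of the irrep turns these traces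
  into Wigner product symbols.  The reproducing kernel follows by integrating \<open>W'\<^bsub>A\<^esub>\<close>
  with \<open>A\<close> a product of two kernels.
\<close>

section \<open>Parseval's identity\<close>

lemma cinner_linear_simps:
  fixes x y z :: "'a::cinner_space"
  shows "cinner x 0 = 0" "cinner 0 x = 0"
    "cinner (x + y) z = cinner x z + cinner y z" "cinner (c *\<^sub>C x) z = cnj c * cinner x z"
proof -
  show "cinner x 0 = 0" for x :: 'a
    by (metis cinner_scale_right cvs.scale_zero_left mult_zero_left)
  then show "cinner 0 x = 0" by (metis cinner_cnj complex_cnj_zero)
  show "cinner (x + y) z = cinner x z + cinner y z"
    by (metis cinner_add_right cinner_cnj complex_cnj_add)
  show "cinner (c *\<^sub>C x) z = cnj c * cinner x z"
    by (metis cinner_scale_right cinner_cnj complex_cnj_mult)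
qed

text \<open>Both sides are linear in \<open>y\<close>, so induction over the span reduces the claim
  to \<open>y = f j\<close>, where orthonormality leaves a single term.\<close>

lemma parseval:
  fixes f :: "'i \<Rightarrow> 'a::cinner_space"
  assumes fin: "finite I"
    and on: "\<And>i j. i \<in> I \<Longrightarrow> j \<in> I \<Longrightarrow> cinner (f i) (f j) = (if i = j then 1 else 0)"
    and y: "y \<in> cvs.span (f ` I)"
  shows "cinner x y = (\<Sum>i\<in>I. cinner x (f i) * cinner (f i) y)"
  using y
proof (induction rule: cvs.span_induct_alt)
  case base
  show ?case by (simp add: cinner_linear_simps)
next
  case (step c v y)
  then obtain j where j: "j \<in> I" "v = f j" by auto
  have "(\<Sum>i\<in>I. cinner x (f i) * cinner (f i) (f j)) = (\<Sum>i\<in>I. if i = j then cinner x (f i) else 0)"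
    by (intro sum.cong refl) (simp add: on j)
  also have "\<dots> = cinner x (f j)"
    using fin j by simp
  finally have *: "(\<Sum>i\<in>I. cinner x (f i) * cinner (f i) v) = cinner x v"
    by (simp add: j)
  have "(\<Sum>i\<in>I. cinner x (f i) * cinner (f i) (c *\<^sub>C v + y)) =
      c * (\<Sum>i\<in>I. cinner x (f i) * cinner (f i) v) + (\<Sum>i\<in>I. cinner x (f i) * cinner (f i) y)"
    by (simp add: cinner_add_right cinner_scale_right distrib_left sum.distrib sum_distrib_left
        mult.left_commute)
  then show ?case
    by (simp add: * step cinner_add_right cinner_scale_right)
qed

lemma inner_matrix_eq_Re_cinner: "A \<bullet> B = Re (cinner A B)" for A B :: "complex^'n^'m"
  by (simp add: inner_vec_def cinner_vec_def cinner_complex_def inner_complex_def)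

text \<open>The real inner product is the real part of \<open>cinner\<close>, so the family is
  orthogonal and nonzero in a finite-dimensional real space, hence independent there. This yields
  finiteness of the Clebsch-Gordan series.\<close>

lemma finite_orthonormal_matrices:
  fixes f :: "'i \<Rightarrow> complex^'n^'m"
  assumes on: "\<And>i j. i \<in> I \<Longrightarrow> j \<in> I \<Longrightarrow> cinner (f i) (f j) = (if i = j then 1 else 0)"
  shows "finite I"
proof -
  have inj: "inj_on f I"
    using on by (metis inj_onI zero_neq_one)
  have "pairwise orthogonal (f ` I)"
    using inj by (auto simp: pairwise_def orthogonal_def inner_matrix_eq_Re_cinner on)
  moreover have "0 \<notin> f ` I"
    using on by (metis (no_types, lifting) cinner_self_eq_0 imageE zero_neq_one)
  ultimately have "finite (f ` I)"
    by (intro finiteI_independent pairwise_orthogonal_independent)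
  then show ?thesis
    using inj by (simp add: finite_image_iff)
qed


section \<open>Adjoints and traces\<close>

lemma mat_adj_mat_adj [simp]: "mat_adj (mat_adj A) = A"
  by (simp add: mat_adj_def vec_eq_iff)

lemma trace_mul_eq_cinner: "trace (A ** B) = cinner (mat_adj A) B" for A B :: "complex^'n^'n"
  by (simp add: cinner_matrix_eq_trace)

lemma cinner_mat_vec_right: "cinner x (A *v y) = cinner (mat_adj A *v x) y"
  for A :: "complex^'n^'m"
proof -
  have "cinner x (A *v y) = (\<Sum>i\<in>UNIV. \<Sum>j\<in>UNIV. cnj (x $ i) * A $ i $ j * y $ j)"
    by (simp add: cinner_vec_def cinner_complex_def matrix_vector_mult_def sum_distrib_left mult.assoc)
  also have "\<dots> = (\<Sum>j\<in>UNIV. \<Sum>i\<in>UNIV. cnj (x $ i) * A $ i $ j * y $ j)"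
    by (rule sum.swap)
  also have "\<dots> = cinner (mat_adj A *v x) y"
    by (simp add: cinner_vec_def cinner_complex_def matrix_vector_mult_def mat_adj_def
        sum_distrib_left sum_distrib_right mult_ac)
  finally show ?thesis .
qed

text \<open>The trace form can be evaluated in any orthonormal basis, here later the GT basis. Each
  coordinate of \<open>A *v v\<close> is the inner product of \<open>v\<close> with a conjugated row
  of \<open>A\<close>, so Parseval applies row by row.\<close>

lemma cinner_matrix_in_orthonormal_basis:
  fixes A B :: "complex^'n^'m" and e :: "'i \<Rightarrow> complex^'n"
  assumes "finite I"
    and "\<And>i j. i \<in> I \<Longrightarrow> j \<in> I \<Longrightarrow> cinner (e i) (e j) = (if i = j then 1 else 0)"
    and "cvs.span (e ` I) = UNIV"
  shows "cinner A B = (\<Sum>l\<in>I. cinner (A *v e l) (B *v e l))"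
proof -
  let ?row = "\<lambda>X::complex^'n^'m. \<lambda>i. (\<chi> j. cnj (X $ i $ j)) :: complex^'n"
  have row: "(X *v v) $ i = cinner (?row X i) v" for X i v
    by (simp add: matrix_vector_mult_def cinner_vec_def cinner_complex_def)
  have "(\<Sum>l\<in>I. cinner (A *v e l) (B *v e l)) =
      (\<Sum>l\<in>I. \<Sum>i\<in>UNIV. cinner (?row B i) (e l) * cinner (e l) (?row A i))"
    unfolding cinner_vec_def[of "A *v _"]
    by (intro sum.cong refl) (simp add: row cinner_complex_def mult.commute flip: cinner_cnj)
  also have "\<dots> = (\<Sum>i\<in>UNIV. \<Sum>l\<in>I. cinner (?row B i) (e l) * cinner (e l) (?row A i))"
    by (rule sum.swap)
  also have "\<dots> = (\<Sum>i\<in>UNIV. cinner (?row B i) (?row A i))"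
    by (intro sum.cong refl parseval[symmetric]) (use assms in auto)
  also have "\<dots> = cinner A B"
    by (simp add: cinner_vec_def cinner_complex_def mult.commute)
  finally show ?thesis by simp
qed


section \<open>GT labels\<close>

lemma finite_gt_labels: "finite (gt_labels a)"
proof -
  obtain p q where a: "a = (p, q)" by (cases a)
  let ?f = "\<lambda>(rp, rm, n3). ((int p + 2 * int q - (rp + rm), rp + rm - n3, n3),
      real_of_int (rp - rm) / 2)"
  have "gt_labels a \<subseteq> ?f ` ({0..int p + int q} \<times> {0..int q} \<times> {0..int p + int q})"
    unfolding gt_labels_def a by (fastforce simp: image_iff)
  then show ?thesis
    by (rule finite_subset) auto
qed

text \<open>Take \<open>rp = q\<close> and \<open>rm = n3 = 0\<close>. This gives every irrep a
  distinguished label, used below to count the irreps in a coupled basis.\<close>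

lemma highest_weight_label: "((int p + int q, int q, 0), real q / 2) \<in> gt_labels (p, q)"
  unfolding gt_labels_def by simp (rule exI[of _ "int q"], rule exI[of _ 0], auto)

lemma dual_irr_dual_irr [simp]: "dual_irr (dual_irr a) = a"
  by (simp add: dual_irr_def)

lemma size_irr_dual_irr [simp]: "size_irr (dual_irr a) = size_irr a"
  by (simp add: size_irr_def dual_irr_def)

lemma dual_label_dual_label [simp]: "size_irr a = size_irr b \<Longrightarrow> dual_label a (dual_label b l) = l"
  by (cases l rule: phase_exp.cases) simp

lemma phase_exp_dual_label [simp]: "phase_exp (dual_label a l) = - phase_exp l"
  by (cases l rule: phase_exp.cases) simp

text \<open>Duality reflects the pattern: \<open>rp\<close> and \<open>rm\<close> exchange roles
  under x -> |a| - x, which preserves their difference and hence J, and turns the bounds around q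
  into bounds around p.\<close>

lemma dual_label_in_gt_labels:
  assumes "l \<in> gt_labels a"
  shows "dual_label a l \<in> gt_labels (dual_irr a)"
proof -
  obtain p q where a: "a = (p, q)" by (cases a)
  obtain rp rm n3 where
    l: "l = ((int p + 2 * int q - (rp + rm), rp + rm - n3, n3), real_of_int (rp - rm) / 2)"
    and r: "0 \<le> rm" "rm \<le> int q" "int q \<le> rp" "rp \<le> int p + int q" "rm \<le> n3" "n3 \<le> rp"
    using assms unfolding gt_labels_def a by auto
  have "\<exists>rp' rm' n3'. dual_label a l =
      ((int q + 2 * int p - (rp' + rm'), rp' + rm' - n3', n3'), real_of_int (rp' - rm') / 2) \<and>
      0 \<le> rm' \<and> rm' \<le> int p \<and> int p \<le> rp' \<and> rp' \<le> int q + int p \<and> rm' \<le> n3' \<and> n3' \<le> rp'"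
    by (rule exI[of _ "int p + int q - rm"], rule exI[of _ "int p + int q - rp"],
        rule exI[of _ "int p + int q - n3"]) (use r in \<open>auto simp: l a size_irr_def\<close>)
  then show ?thesis
    unfolding gt_labels_def a dual_irr_def by simp
qed

lemma bij_betw_dual_label: "bij_betw (dual_label (dual_irr a)) (gt_labels (dual_irr a)) (gt_labels a)"
  by (rule bij_betw_byWitness[where f' = "dual_label a"])
    (use dual_label_in_gt_labels[of _ "dual_irr a"] dual_label_in_gt_labels[of _ a] in auto)

lemma minus_one_powi_square: "(- 1) powi k * (- 1) powi k = (1::complex)"
  by (simp flip: power_int_mult_distrib)

lemma minus_one_powi_uminus: "(- 1) powi (- k) = ((- 1) powi k :: complex)"
  by (simp add: power_int_minus flip: power_int_inverse)

lemma cnj_minus_one_powi: "cnj ((- 1) powi k) = (- 1) powi k"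
  by (simp add: power_int_def)


section \<open>Clebsch-Gordan coefficients and Wigner product symbols\<close>

lemma gt_basis_orthonormal:
  assumes "gt_basis V R a e" "l \<in> gt_labels a" "l' \<in> gt_labels a"
  shows "cinner (e l) (e l') = (if l = l' then 1 else 0)"
  using assms by (cases a) (auto simp: gt_basis_def)

lemma gt_basis_span: "gt_basis V R a e \<Longrightarrow> cvs.span (e ` gt_labels a) = V"
  by (cases a) (auto simp: gt_basis_def)

text \<open>The operator is of rank one, with entries \<open>c * cnj (x $ j) * v $ i\<close>, found
  by evaluating the functional on the standard basis.\<close>

lemma cinner_tensor_op:
  fixes A :: "complex^'n^'n"
  shows "cinner A (tensor_op v (\<lambda>w. c * cinner x w)) = c * cinner (A *v x) v"
proof -
  have "cinner x (axis j 1) = cnj (x $ j)" for j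
    by (simp add: cinner_vec_def cinner_complex_def axis_def if_distrib cong: if_cong)
  then have "cinner A (tensor_op v (\<lambda>w. c * cinner x w)) =
      (\<Sum>i\<in>UNIV. \<Sum>j\<in>UNIV. cnj (A $ i $ j) * (c * cnj (x $ j) * v $ i))"
    by (simp add: cinner_vec_def cinner_complex_def tensor_op_def matrix_def cscale_vec_def
        cscale_complex_def)
  also have "\<dots> = c * cinner (A *v x) v"
    by (simp add: cinner_vec_def cinner_complex_def matrix_vector_mult_def sum_distrib_left
        sum_distrib_right mult_ac)
  finally show ?thesis .
qed

text \<open>The dual label converts the dual basis vector back to a vector of \<open>e\<close>, so a
  Clebsch-Gordan coefficient is, up to sign, a conjugated matrix element of a coupled basis
  operator.\<close>

lemma CG_coeff_eq_matrix_element: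
  "CG_coeff p e ec l1 l2 s l =
    (- 1) powi phase_exp l2 *
    cinner (ec (fst s) (snd s) l *v e (dual_label (dual_irr p) l2)) (e l1)"
  by (simp add: CG_coeff_def dual_gt_def Let_def cinner_tensor_op minus_one_powi_uminus)

text \<open>Replacing the coefficients by matrix elements makes the sum over \<mu>1, \<mu>2, \<mu>3
  the trace of a product of three matrices written out in the basis \<open>e\<close>.\<close>

lemma wigner_product_symbol_eq_cinner:
  fixes e :: "gt_label \<Rightarrow> complex^'n"
  assumes gt: "gt_basis UNIV R p e"
    and real: "\<And>s l1 l2 l. s \<in> {s1, s2} \<Longrightarrow> l1 \<in> gt_labels p \<Longrightarrow> l2 \<in> gt_labels (dual_irr p) \<Longrightarrow>
      l \<in> gt_labels (fst s) \<Longrightarrow> CG_coeff p e ec l1 l2 s l \<in> \<real>"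
    and l1: "l1 \<in> gt_labels (fst s1)" and l2: "l2 \<in> gt_labels (fst s2)"
  shows "wigner_product_symbol p e ec s1 s2 s l1 l2 l =
    (- 1) powi (size_irr p + phase_exp l) *
    cinner (ec (fst s) (snd s) (dual_label (dual_irr (fst s)) l))
      (ec (fst s1) (snd s1) l1 ** ec (fst s2) (snd s2) l2)"
proof -
  let ?d = "dual_label (dual_irr p)"
  let ?G = "gt_labels p" and ?G' = "gt_labels (dual_irr p)"
  let ?s = "\<lambda>l. (- 1) powi phase_exp l :: complex"
  define A where "A = ec (fst s1) (snd s1) l1"
  define B where "B = ec (fst s2) (snd s2) l2"
  define D where "D = ec (fst s) (snd s) (dual_label (dual_irr (fst s)) l)"
  have pars: "cinner x y = (\<Sum>k\<in>?G. cinner x (e k) * cinner (e k) y)" for x y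
    by (rule parseval) (use finite_gt_labels gt_basis_orthonormal[OF gt] gt_basis_span[OF gt] in auto)
  have d: "?d \<mu> \<in> ?G" if "\<mu> \<in> ?G'" for \<mu>
    using dual_label_in_gt_labels[OF that] by simp
  \<comment> \<open>Reality of the coefficient undoes the conjugation, putting \<open>A\<close> in
    the second slot as the matrix product requires. The third factor \<open>D\<close> enters through
    its adjoint and keeps its conjugation.\<close>
  have CGA: "CG_coeff p e ec \<mu> \<nu> s1 l1 = ?s \<nu> * cinner (e \<mu>) (A *v e (?d \<nu>))"
    if "\<mu> \<in> ?G" "\<nu> \<in> ?G'" for \<mu> \<nu>
  proof -
    have "CG_coeff p e ec \<mu> \<nu> s1 l1 = cnj (CG_coeff p e ec \<mu> \<nu> s1 l1)"
      using real[of s1 \<mu> \<nu> l1] that l1 by (simp add: Reals_cnj_iff)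
    then show ?thesis
      by (simp add: CG_coeff_eq_matrix_element cnj_minus_one_powi A_def flip: cinner_cnj)
  qed
  have CGB: "CG_coeff p e ec \<mu> \<nu> s2 l2 = ?s \<nu> * cinner (e \<mu>) (B *v e (?d \<nu>))"
    if "\<mu> \<in> ?G" "\<nu> \<in> ?G'" for \<mu> \<nu>
  proof -
    have "CG_coeff p e ec \<mu> \<nu> s2 l2 = cnj (CG_coeff p e ec \<mu> \<nu> s2 l2)"
      using real[of s2 \<mu> \<nu> l2] that l2 by (simp add: Reals_cnj_iff)
    then show ?thesis
      by (simp add: CG_coeff_eq_matrix_element cnj_minus_one_powi B_def flip: cinner_cnj)
  qed
  have "cinner D (A ** B) = (\<Sum>k\<in>?G. cinner (D *v e k) (A *v (B *v e k)))"
    by (subst cinner_matrix_in_orthonormal_basis[where I = ?G and e = e])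
      (use finite_gt_labels gt_basis_orthonormal[OF gt] gt_basis_span[OF gt] in
        \<open>auto simp: matrix_vector_mul_assoc\<close>)
  \<comment> \<open>A resolution of the identity goes between \<open>A\<close> and \<open>B\<close>,
    once \<open>A\<close> is moved to the left slot as its adjoint; the next step inserts one
    between \<open>D\<close> and \<open>A\<close>.\<close>
  also have "\<dots> = (\<Sum>k\<in>?G. \<Sum>j\<in>?G. cinner (D *v e k) (A *v e j) * cinner (e j) (B *v e k))"
    unfolding cinner_mat_vec_right[of _ A] by (intro sum.cong refl pars)
  also have "\<dots> = (\<Sum>k\<in>?G. \<Sum>j\<in>?G. \<Sum>i\<in>?G.
      cinner (D *v e k) (e i) * cinner (e i) (A *v e j) * cinner (e j) (B *v e k))"
    by (subst pars) (simp add: sum_distrib_right)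
  \<comment> \<open>The indices \<open>k\<close> and \<open>j\<close> become dual labels, since
    \<mu>3 and \<mu>2 range over the labels of the dual irrep in the symbol.\<close>
  also have "\<dots> = (\<Sum>\<mu>3\<in>?G'. \<Sum>\<mu>2\<in>?G'. \<Sum>\<mu>1\<in>?G.
      cinner (D *v e (?d \<mu>3)) (e \<mu>1) * cinner (e \<mu>1) (A *v e (?d \<mu>2)) *
      cinner (e (?d \<mu>2)) (B *v e (?d \<mu>3)))"
    by (simp only: sum.reindex_bij_betw[OF bij_betw_dual_label[of p], symmetric])
  also have "\<dots> = (\<Sum>\<mu>1\<in>?G. \<Sum>\<mu>2\<in>?G'. \<Sum>\<mu>3\<in>?G'.
      cinner (D *v e (?d \<mu>3)) (e \<mu>1) * cinner (e \<mu>1) (A *v e (?d \<mu>2)) *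
      cinner (e (?d \<mu>2)) (B *v e (?d \<mu>3)))"
    by (subst sum.swap, subst (2) sum.swap, subst sum.swap, rule refl)
  also have "\<dots> = (\<Sum>\<mu>1\<in>?G. \<Sum>\<mu>2\<in>?G'. \<Sum>\<mu>3\<in>?G'. ?s \<mu>2
        * CG_coeff p e ec \<mu>1 \<mu>2 s1 l1 * CG_coeff p e ec (?d \<mu>2) \<mu>3 s2 l2
        * CG_coeff p e ec \<mu>1 \<mu>3 s (dual_label (dual_irr (fst s)) l))"
  proof (intro sum.cong refl)
    fix \<mu>1 \<mu>2 \<mu>3 assume \<mu>: "\<mu>1 \<in> ?G" "\<mu>2 \<in> ?G'" "\<mu>3 \<in> ?G'"
    let ?x = "cinner (D *v e (?d \<mu>3)) (e \<mu>1)" and ?y = "cinner (e \<mu>1) (A *v e (?d \<mu>2))"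
      and ?z = "cinner (e (?d \<mu>2)) (B *v e (?d \<mu>3))"
    \<comment> \<open>The sign of \<mu>2 occurs in the symbol's own phase and in the first
      coefficient, that of \<mu>3 in the second and third, so both square to 1.\<close>
    have "?s \<mu>2 * CG_coeff p e ec \<mu>1 \<mu>2 s1 l1 * CG_coeff p e ec (?d \<mu>2) \<mu>3 s2 l2
        * CG_coeff p e ec \<mu>1 \<mu>3 s (dual_label (dual_irr (fst s)) l) =
        (?s \<mu>2 * ?s \<mu>2) * (?s \<mu>3 * ?s \<mu>3) * (?x * ?y * ?z)"
      by (simp only: CGA[OF \<mu>(1,2)] CGB[OF d[OF \<mu>(2)] \<mu>(3)]
          CG_coeff_eq_matrix_element[of _ _ _ _ _ s] D_def mult_ac)
    then show "?x * ?y * ?z = ?s \<mu>2 * CG_coeff p e ec \<mu>1 \<mu>2 s1 l1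
        * CG_coeff p e ec (?d \<mu>2) \<mu>3 s2 l2
        * CG_coeff p e ec \<mu>1 \<mu>3 s (dual_label (dual_irr (fst s)) l)"
      by (simp only: minus_one_powi_square mult_1)
  qed
  finally show ?thesis
    by (simp add: wigner_product_symbol_def power_int_add sum_distrib_left mult.assoc
        flip: A_def B_def D_def)
qed


section \<open>Coupled bases\<close>

lemma coupled_basis_orthonormal:
  assumes cb: "coupled_basis \<rho> m ec"
    and s: "s \<in> cg_series m" "l \<in> gt_labels (fst s)"
    and s': "s' \<in> cg_series m" "l' \<in> gt_labels (fst s')"
  shows "cinner (ec (fst s) (snd s) l) (ec (fst s') (snd s') l') =
    (if s = s' \<and> l = l' then 1 else 0)"
proof (cases "s = s'")
  case True
  obtain V where "gt_basis V (op_action \<rho>) (fst s) (ec (fst s) (snd s))"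
    using cb s unfolding coupled_basis_def by (auto simp: split_def)
  from gt_basis_orthonormal[OF this] show ?thesis
    using s s' True by auto
next
  case False
  then show ?thesis
    using cb s s' unfolding coupled_basis_def by (cases s; cases s') fastforce
qed

text \<open>Choosing the highest weight vector in each irrep gives an orthonormal family of matrices
  indexed by the series itself.\<close>

lemma finite_cg_series:
  fixes ec :: "irr \<Rightarrow> nat \<Rightarrow> gt_label \<Rightarrow> complex^'n^'n"
  assumes "coupled_basis \<rho> m ec"
  shows "finite (cg_series m)"
proof -
  define h :: "irr \<Rightarrow> gt_label" where "h = (\<lambda>(p, q). ((int p + int q, int q, 0), real q / 2))"
  have h: "h a \<in> gt_labels a" for a
    using highest_weight_label[of "fst a" "snd a"] by (simp add: h_def split_def)
  show ?thesis
    by (rule finite_orthonormal_matrices[where f = "\<lambda>s. ec (fst s) (snd s) (h (fst s))"])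
      (auto simp: coupled_basis_orthonormal[OF assms _ h _ h])
qed

lemma coupled_basis_parseval:
  fixes ec :: "irr \<Rightarrow> nat \<Rightarrow> gt_label \<Rightarrow> complex^'n^'n"
  assumes cb: "coupled_basis \<rho> m ec"
  shows "cinner A B = (\<Sum>s\<in>cg_series m. \<Sum>l\<in>gt_labels (fst s).
    cinner A (ec (fst s) (snd s) l) * cinner (ec (fst s) (snd s) l) B)"
proof -
  let ?I = "Sigma (cg_series m) (\<lambda>s. gt_labels (fst s))"
  let ?f = "\<lambda>(s, l). ec (fst s) (snd s) l"
  have "?f ` ?I = (\<Union>(a, \<sigma>)\<in>cg_series m. ec a \<sigma> ` gt_labels a)"
    by (auto simp: image_iff split_def) force+
  then have "cvs.span (?f ` ?I) = UNIV"
    using cb by (simp add: coupled_basis_def)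
  moreover have "cinner (?f i) (?f j) = (if i = j then 1 else 0)" if "i \<in> ?I" "j \<in> ?I" for i j
    using that coupled_basis_orthonormal[OF cb, of "fst i" "snd i" "fst j" "snd j"]
    by (auto simp: split_def prod_eq_iff)
  ultimately have "cinner A B = (\<Sum>i\<in>?I. cinner A (?f i) * cinner (?f i) B)"
    by (intro parseval) (simp_all add: finite_cg_series[OF cb] finite_gt_labels)
  then show ?thesis
    by (simp add: sum.Sigma finite_cg_series[OF cb] finite_gt_labels split_def)
qed

text \<open>The adjoint convention makes the series closed under duality at fixed \<sigma>. This
  allows the third kernel to be expanded over dual irreps.\<close>

lemma bij_betw_dual_cg_series:
  assumes "coupled_phase_conventions p e m ec"
  shows "bij_betw (\<lambda>s. (dual_irr (fst s), snd s)) (cg_series m) (cg_series m)"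
  by (rule bij_betw_byWitness[where f' = "\<lambda>s. (dual_irr (fst s), snd s)"])
    (use assms in \<open>auto simp: coupled_phase_conventions_def\<close>)

text \<open>The adjoint convention identifies the third factor, up to sign, with the adjoint of the
  vector entering the symbol. That sign cancels the \<open>l3\<close> phase of the symbol, leaving
  only the sign of |p|.\<close>

lemma trace_triple_product_eq_wigner_product_symbol:
  fixes e :: "gt_label \<Rightarrow> complex^'n"
  assumes gt: "gt_basis UNIV R p e"
    and ph: "coupled_phase_conventions p e m ec"
    and s1: "s1 \<in> cg_series m" "l1 \<in> gt_labels (fst s1)"
    and s2: "s2 \<in> cg_series m" "l2 \<in> gt_labels (fst s2)"
    and s3: "s3 \<in> cg_series m" "l3 \<in> gt_labels (dual_irr (fst s3))"
  shows "trace (ec (fst s1) (snd s1) l1 ** ec (fst s2) (snd s2) l2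
      ** ec (dual_irr (fst s3)) (snd s3) l3) =
    (- 1) powi size_irr p * wigner_product_symbol p e ec s1 s2 s3 l1 l2 l3"
proof -
  let ?AB = "ec (fst s1) (snd s1) l1 ** ec (fst s2) (snd s2) l2"
  let ?D = "ec (dual_irr (fst s3)) (snd s3) l3"
  let ?D' = "ec (fst s3) (snd s3) (dual_label (dual_irr (fst s3)) l3)"
  have "(dual_irr (fst s3), snd s3) \<in> cg_series m"
    using bij_betwE[OF bij_betw_dual_cg_series[OF ph]] s3 by auto
  then have "mat_adj ?D = (- 1) powi phase_exp l3 *\<^sub>C ?D'"
    using ph s3(2) unfolding coupled_phase_conventions_def by fastforce
  then have "trace (?AB ** ?D) = (- 1) powi phase_exp l3 * cinner ?D' ?AB"
    by (subst trace_mul_sym) (simp add: trace_mul_eq_cinner cinner_linear_simps cnj_minus_one_powi)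
  moreover have "wigner_product_symbol p e ec s1 s2 s3 l1 l2 l3 =
      (- 1) powi (size_irr p + phase_exp l3) * cinner ?D' ?AB"
    by (rule wigner_product_symbol_eq_cinner[OF gt])
      (use ph s1 s2 in \<open>auto simp: coupled_phase_conventions_def\<close>)
  ultimately show ?thesis
    using minus_one_powi_square[of "size_irr p"] by (simp add: power_int_add flip: mult.assoc)
qed


section \<open>Operator kernels\<close>

lemma dim_irr_pos: "dim_irr a > 0"
  by (simp add: dim_irr_def)

lemma symbol_of_coupled_basis:
  assumes sc: "symbol_correspondence p \<rho> M W"
    and cm: "characteristic_matrices p m ec W C"
    and s: "s \<in> cg_series m" "l \<in> gt_labels (fst s)" and z: "z \<in> flags"
  shows "W (ec (fst s) (snd s) l) z =
    harmonic_comb C (fst s) (snd s) l z / complex_of_real (sqrt (dim_irr p))"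
proof -
  have "complex_of_real (sqrt (dim_irr p)) * W (ec (fst s) (snd s) l) z =
      W (complex_of_real (sqrt (dim_irr p)) *\<^sub>C ec (fst s) (snd s) l) z"
    using sc z by (simp add: symbol_correspondence_def)
  also have "\<dots> = harmonic_comb C (fst s) (snd s) l z"
    using cm s z by (cases s) (auto simp: characteristic_matrices_def)
  finally show ?thesis
    using dim_irr_pos[of p] by (simp add: field_simps)
qed

text \<open>This is the coupled basis expansion of \<open>K z\<close>, tested against an arbitrary
  \<open>A\<close> so that it can be applied to each kernel inside a product. The factor on the left
  clears the normalisation of the characteristic matrices.\<close>

lemma trace_mul_operator_kernel:
  fixes ec :: "irr \<Rightarrow> nat \<Rightarrow> gt_label \<Rightarrow> complex^'n^'n"
  assumes cb: "coupled_basis \<rho> m ec"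
    and sc: "symbol_correspondence p \<rho> M W"
    and ok: "operator_kernel \<rho> W K"
    and cm: "characteristic_matrices p m ec W C"
    and z: "z \<in> flags"
  shows "complex_of_real (sqrt (dim_irr p)) * trace (A ** K z) =
    (\<Sum>s\<in>cg_series m. \<Sum>l\<in>gt_labels (fst s).
      cnj (harmonic_comb C (fst s) (snd s) l z) * trace (A ** ec (fst s) (snd s) l))"
proof -
  have W: "W A z = trace (A ** K z)" "W (mat_adj A) z = cnj (W A z)" for A
    using ok sc z by (auto simp: operator_kernel_def symbol_correspondence_def)
  have "cinner (ec (fst s) (snd s) l) (K z) =
      cnj (harmonic_comb C (fst s) (snd s) l z) / complex_of_real (sqrt (dim_irr p))"
    if "s \<in> cg_series m" "l \<in> gt_labels (fst s)" for s l
  proof -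
    have "cinner (ec (fst s) (snd s) l) (K z) = W (mat_adj (ec (fst s) (snd s) l)) z"
      by (simp add: W(1) cinner_matrix_eq_trace)
    then show ?thesis
      by (simp add: W(2) symbol_of_coupled_basis[OF sc cm that z])
  qed
  then have "trace (A ** K z) = (\<Sum>s\<in>cg_series m. \<Sum>l\<in>gt_labels (fst s).
      trace (A ** ec (fst s) (snd s) l) *
      (cnj (harmonic_comb C (fst s) (snd s) l z) / complex_of_real (sqrt (dim_irr p))))"
    unfolding trace_mul_eq_cinner by (subst coupled_basis_parseval[OF cb]) simp
  then show ?thesis
    using dim_irr_pos[of p] by (simp add: sum_distrib_left mult_ac)
qed

text \<open>Both of the first two slots carry \<open>K'\<close>. Cyclicity of the trace moves the
  integrated kernel to the end, where it produces \<open>W' A z\<close>; the normalisation of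
  \<open>W'\<close> then leaves one factor \<open>dim_irr p\<close>.\<close>

lemma trikernel_integrals:
  assumes M: "space M = flags"
    and sc: "symbol_correspondence p \<rho> M W'"
    and ok: "operator_kernel \<rho> W' K'"
  shows "(LINT z|M. trikernel p K' K z z1 z2) = complex_of_real (dim_irr p) * trace (K' z1 ** K z2)"
    and "(LINT z|M. trikernel p K' K z1 z z2) = complex_of_real (dim_irr p) * trace (K' z1 ** K z2)"
proof -
  have int: "(LINT z|M. (complex_of_real (dim_irr p))\<^sup>2 * W' A z) = complex_of_real (dim_irr p) * trace A"
    for A
    using sc dim_irr_pos[of p] by (simp add: symbol_correspondence_def power2_eq_square)
  have W: "W' A z = trace (A ** K' z)" if "z \<in> flags" for A z
    using ok that by (simp add: operator_kernel_def)
  have "(LINT z|M. trikernel p K' K z z1 z2) =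
      (LINT z|M. (complex_of_real (dim_irr p))\<^sup>2 * W' (K' z1 ** K z2) z)"
    by (rule Bochner_Integration.integral_cong)
      (auto simp: M W trikernel_def matrix_mul_assoc[symmetric] trace_mul_sym[of "K' _"])
  then show "(LINT z|M. trikernel p K' K z z1 z2) =
      complex_of_real (dim_irr p) * trace (K' z1 ** K z2)"
    by (simp only: int)
  have "(LINT z|M. trikernel p K' K z1 z z2) =
      (LINT z|M. (complex_of_real (dim_irr p))\<^sup>2 * W' (K z2 ** K' z1) z)"
    by (rule Bochner_Integration.integral_cong)
      (auto simp: M W trikernel_def trace_mul_sym[of _ "K z2"] matrix_mul_assoc)
  then show "(LINT z|M. trikernel p K' K z1 z z2) =
      complex_of_real (dim_irr p) * trace (K' z1 ** K z2)"
    by (simp only: int trace_mul_sym[of "K z2"])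
qed

text \<open>Expanding kernels one after another alternates irreps and labels, while the final
  formula lists all irreps first. The exchange is legitimate because each label set depends only on
  its own irrep.\<close>

lemma sum_interleave:
  "(\<Sum>s\<in>S. \<Sum>i\<in>X s. \<Sum>t\<in>S. \<Sum>j\<in>Y t. \<Sum>u\<in>S. \<Sum>k\<in>Z u. f s t u i j k) =
   (\<Sum>s\<in>S. \<Sum>t\<in>S. \<Sum>u\<in>S. \<Sum>i\<in>X s. \<Sum>j\<in>Y t. \<Sum>k\<in>Z u. f s t u i j k)"
  for f :: "'s \<Rightarrow> 's \<Rightarrow> 's \<Rightarrow> 'i \<Rightarrow> 'i \<Rightarrow> 'i \<Rightarrow> 'a::comm_monoid_add"
proof (rule sum.cong[OF refl])
  fix s
  have "(\<Sum>i\<in>X s. \<Sum>t\<in>S. \<Sum>j\<in>Y t. \<Sum>u\<in>S. \<Sum>k\<in>Z u. f s t u i j k) =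
      (\<Sum>t\<in>S. \<Sum>i\<in>X s. \<Sum>j\<in>Y t. \<Sum>u\<in>S. \<Sum>k\<in>Z u. f s t u i j k)"
    by (rule sum.swap)
  also have "\<dots> = (\<Sum>t\<in>S. \<Sum>i\<in>X s. \<Sum>u\<in>S. \<Sum>j\<in>Y t. \<Sum>k\<in>Z u. f s t u i j k)"
    by (intro sum.cong refl sum.swap)
  also have "\<dots> = (\<Sum>t\<in>S. \<Sum>u\<in>S. \<Sum>i\<in>X s. \<Sum>j\<in>Y t. \<Sum>k\<in>Z u. f s t u i j k)"
    by (intro sum.cong refl sum.swap)
  finally show "(\<Sum>i\<in>X s. \<Sum>t\<in>S. \<Sum>j\<in>Y t. \<Sum>u\<in>S. \<Sum>k\<in>Z u. f s t u i j k) =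
      (\<Sum>t\<in>S. \<Sum>u\<in>S. \<Sum>i\<in>X s. \<Sum>j\<in>Y t. \<Sum>k\<in>Z u. f s t u i j k)" .
qed

theorem corollary5p30:
  fixes p :: irr
    and \<rho> :: "complex^3^3 \<Rightarrow> complex^'n^'n"
    and e :: "gt_label \<Rightarrow> complex^'n"
    and m :: "irr \<Rightarrow> nat"
    and ec :: "irr \<Rightarrow> nat \<Rightarrow> gt_label \<Rightarrow> complex^'n^'n"
    and M :: "flag_pt measure"
    and W W' :: "complex^'n^'n \<Rightarrow> flag_pt \<Rightarrow> complex"
    and K K' :: "flag_pt \<Rightarrow> complex^'n^'n"
    and C C' :: "irr \<Rightarrow> nat \<Rightarrow> nat \<Rightarrow> complex"
  assumes "p \<noteq> (0, 0)"
    and "unitary_irrep UNIV (vec_action \<rho>) p"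
    and "gt_basis UNIV (vec_action \<rho>) p e"
    and "coupled_basis \<rho> m ec"
    and "coupled_phase_conventions p e m ec"
    and "invariant_flag_measure M"
    and "symbol_correspondence p \<rho> M W"
    and "operator_kernel \<rho> W K"
    and "characteristic_matrices p m ec W C"
    and "canonical_dual p \<rho> M W W'"
    and "operator_kernel \<rho> W' K'"
    and "characteristic_matrices p m ec W' C'"
  shows "(\<forall>z1\<in>flags. \<forall>z2\<in>flags. \<forall>z3\<in>flags.
      trikernel p K' K z1 z2 z3 =
        (complex_of_real (dim_irr p))\<^sup>2 * trace (K' z1 ** K' z2 ** K z3) \<and>
      trikernel p K' K z1 z2 z3 =
        (- 1) powi size_irr p * complex_of_real (sqrt (dim_irr p)) *
        (\<Sum>(a1, \<sigma>1)\<in>cg_series m. \<Sum>(a2, \<sigma>2)\<in>cg_series m. \<Sum>(a3, \<sigma>3)\<in>cg_series m.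
         \<Sum>l1\<in>gt_labels a1. \<Sum>l2\<in>gt_labels a2. \<Sum>l3\<in>gt_labels (dual_irr a3).
           wigner_product_symbol p e ec (a1, \<sigma>1) (a2, \<sigma>2) (a3, \<sigma>3) l1 l2 l3
           * cnj (harmonic_comb C' a1 \<sigma>1 l1 z1)
           * cnj (harmonic_comb C' a2 \<sigma>2 l2 z2)
           * cnj (harmonic_comb C (dual_irr a3) \<sigma>3 l3 z3)))
    \<and> (\<forall>z1\<in>flags. \<forall>z2\<in>flags.
      reproducing_kernel M (trikernel p K' K) z1 z2 =
        (\<Sum>(a, \<sigma>)\<in>cg_series m. \<Sum>l\<in>gt_labels a.
           cnj (harmonic_comb C' a \<sigma> l z1) * harmonic_comb C a \<sigma> l z2) \<and>
      (LINT z|M. trikernel p K' K z1 z z2) = reproducing_kernel M (trikernel p K' K) z1 z2)"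
proof -
  note gt = assms(3) and cb = assms(4) and ph = assms(5) and sc = assms(7) and ok = assms(8)
    and cm = assms(9) and ok' = assms(11) and cm' = assms(12)
  have sc': "symbol_correspondence p \<rho> M W'"
    using assms(10) by (simp add: canonical_dual_def)
  have M: "space M = flags"
    using assms(6) by (simp add: invariant_flag_measure_def)
  let ?r = "complex_of_real (sqrt (dim_irr p))"
  let ?S = "cg_series m"
  let ?h = "\<lambda>C s l z. cnj (harmonic_comb C (fst s) (snd s) l z)"
  let ?E = "\<lambda>s. ec (fst s) (snd s)"
  have r: "complex_of_real (dim_irr p) = ?r * ?r" "?r \<noteq> 0"
    using dim_irr_pos[of p] by (simp_all flip: of_real_mult)
  note tK = trace_mul_operator_kernel[OF cb sc ok cm]
  note tK' = trace_mul_operator_kernel[OF cb sc' ok' cm']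
  have tri: "trikernel p K' K z1 z2 z3 = (- 1) powi size_irr p * ?r *
      (\<Sum>s1\<in>?S. \<Sum>s2\<in>?S. \<Sum>s3\<in>?S.
        \<Sum>l1\<in>gt_labels (fst s1). \<Sum>l2\<in>gt_labels (fst s2). \<Sum>l3\<in>gt_labels (dual_irr (fst s3)).
          wigner_product_symbol p e ec s1 s2 s3 l1 l2 l3
          * ?h C' s1 l1 z1 * ?h C' s2 l2 z2 * ?h C (dual_irr (fst s3), snd s3) l3 z3)"
    if z: "z1 \<in> flags" "z2 \<in> flags" "z3 \<in> flags" for z1 z2 z3
  proof -
    \<comment> \<open>Cyclicity brings the kernel to the last position, where the expansion applies;
      the same holds for \<open>t2\<close>.\<close>
    have t1: "?r * trace (K' z1 ** B ** D) =
        (\<Sum>s\<in>?S. \<Sum>l\<in>gt_labels (fst s). ?h C' s l z1 * trace (?E s l ** B ** D))" for B D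
      using tK'[OF z(1), of "B ** D"]
      by (simp only: trace_mul_sym[of "B ** D"] matrix_mul_assoc)
    have t2: "?r * trace (A ** K' z2 ** D) =
        (\<Sum>s\<in>?S. \<Sum>l\<in>gt_labels (fst s). ?h C' s l z2 * trace (A ** ?E s l ** D))" for A D
      using tK'[OF z(2), of "D ** A"]
      by (simp only: trace_mul_sym[of D] matrix_mul_assoc[symmetric])
    \<comment> \<open>The sum is reindexed by duality, which produces the dual irrep in
      \<open>C\<close> and in the label set.\<close>
    have t3: "?r * trace (A ** K z3) = (\<Sum>s\<in>?S. \<Sum>l\<in>gt_labels (dual_irr (fst s)).
        ?h C (dual_irr (fst s), snd s) l z3 * trace (A ** ec (dual_irr (fst s)) (snd s) l))" for A
      by (subst tK[OF z(3)], subst sum.reindex_bij_betw[OF bij_betw_dual_cg_series[OF ph], symmetric])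
        simp
    \<comment> \<open>A directed form of commutativity: it carries \<open>?r\<close> inward past the
      harmonics to the trace that is expanded next.\<close>
    have push: "?r * (cnj y * x) = cnj y * (?r * x)" for x y
      by (rule mult.left_commute)
    \<comment> \<open>Each of the three expansions consumes one \<open>?r\<close>. The prefactor of
      the trikernel is the fourth power of \<open>?r\<close>, so one \<open>?r\<close> survives as
      the square root in the result.\<close>
    have "?r ^ 3 * trace (K' z1 ** K' z2 ** K z3) =
        ?r * (?r * (?r * trace (K' z1 ** K' z2 ** K z3)))"
      by (simp add: power3_eq_cube)
    also have "\<dots> = (\<Sum>s1\<in>?S. \<Sum>l1\<in>gt_labels (fst s1). \<Sum>s2\<in>?S. \<Sum>l2\<in>gt_labels (fst s2).
        \<Sum>s3\<in>?S. \<Sum>l3\<in>gt_labels (dual_irr (fst s3)). ?h C' s1 l1 z1 * (?h C' s2 l2 z2 *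
          (?h C (dual_irr (fst s3), snd s3) l3 z3 *
            trace (?E s1 l1 ** ?E s2 l2 ** ec (dual_irr (fst s3)) (snd s3) l3))))"
      by (subst t1, simp only: sum_distrib_left push, subst t2, simp only: sum_distrib_left push t3)
    also have "\<dots> = (\<Sum>s1\<in>?S. \<Sum>s2\<in>?S. \<Sum>s3\<in>?S.
        \<Sum>l1\<in>gt_labels (fst s1). \<Sum>l2\<in>gt_labels (fst s2). \<Sum>l3\<in>gt_labels (dual_irr (fst s3)).
          ?h C' s1 l1 z1 * (?h C' s2 l2 z2 * (?h C (dual_irr (fst s3), snd s3) l3 z3 *
            trace (?E s1 l1 ** ?E s2 l2 ** ec (dual_irr (fst s3)) (snd s3) l3))))"
      by (rule sum_interleave)
    also have "\<dots> = (\<Sum>s1\<in>?S. \<Sum>s2\<in>?S. \<Sum>s3\<in>?S.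
        \<Sum>l1\<in>gt_labels (fst s1). \<Sum>l2\<in>gt_labels (fst s2). \<Sum>l3\<in>gt_labels (dual_irr (fst s3)).
          (- 1) powi size_irr p * (wigner_product_symbol p e ec s1 s2 s3 l1 l2 l3
          * ?h C' s1 l1 z1 * ?h C' s2 l2 z2 * ?h C (dual_irr (fst s3), snd s3) l3 z3))"
      by (intro sum.cong refl)
        (simp only: trace_triple_product_eq_wigner_product_symbol[OF gt ph] mult_ac)
    finally show ?thesis
      by (simp add: trikernel_def r(1) sum_distrib_left[symmetric] power2_eq_square power3_eq_cube
          mult.assoc mult.left_commute)
  qed
  have rep: "complex_of_real (dim_irr p) * trace (K' z1 ** K z2) =
      (\<Sum>s\<in>?S. \<Sum>l\<in>gt_labels (fst s).
        ?h C' s l z1 * harmonic_comb C (fst s) (snd s) l z2)"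
    if z: "z1 \<in> flags" "z2 \<in> flags" for z1 z2
  proof -
    \<comment> \<open>Only \<open>K' z1\<close> is expanded: pairing \<open>K z2\<close> with a
      coupled basis vector already gives a value of \<open>W\<close>, without conjugation. The two
      steps use one \<open>?r\<close> each, together \<open>dim_irr p\<close>.\<close>
    have "?r * trace (K z2 ** ?E s l) = harmonic_comb C (fst s) (snd s) l z2"
      if "s \<in> ?S" "l \<in> gt_labels (fst s)" for s l
      using symbol_of_coupled_basis[OF sc cm that z(2)] ok z(2) r(2)
      by (simp add: operator_kernel_def trace_mul_sym[of "K z2"])
    then show ?thesis
      by (simp add: r(1) mult.assoc trace_mul_sym[of "K' z1"] tK'[OF z(1)] sum_distrib_left
          mult.left_commute[of ?r])
  qed
  \<comment> \<open>Both partial integrals reduce to the same trace, which gives the equality of the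
    two forms of the reproducing kernel.\<close>
  show ?thesis
    unfolding reproducing_kernel_def trikernel_integrals[OF M sc' ok'] split_def
    by (intro conjI ballI) (rule trikernel_def, simp_all add: tri rep)
qed

end
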